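(* Let $r\ge1$ be an integer and let $\alpha^{(j)}=\langle\alpha_n^{(j)}\rangle_{n\in\mathbb{N}}$, $j=1,\dots,r$, be sequences of real numbers in $(0,1)$ with $\lim_{n\to\infty}\alpha_n^{(1)}=1$. Let $\langle q_n\rangle$ be a sequence in $(0,1)$ with $\lim_{n\to\infty}q_n=1$ and $\lim_{n\to\infty}q_n^n=a$ for some $a\in[0,1)$. Let $\langle b_n\rangle,\langle c_n\rangle$ be sequences of non-negative integers with $b_n<c_n$ for all $n$ and $\lim_{n\to\infty}c_n=\infty$, let $\langle s_n\rangle$ be a sequence of non-negative real numbers with $S_n=\sum_{m=b_n+1}^{c_n}s_m>0$ for all $n$, and let $A=(a_{n,k})_{n,k\ge1}$ be a non-negative deferred weighted regular matrix (with respect to these sequences). Then for every $g\in\mathfrak{C}([0,1])$, $$stat_A^{DW}\text{-}\lim_n\big\|\mathfrak{R}_{n,q_n}^{\alpha^{(1)},\dots,\alpha^{(r)}}(g)-g\big\|=0,$$ where $\|\cdot\|$ is the sup-norm on $[0,1]$.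
   Context: For $q\in(0,1)$: $[n]_q=\frac{1-q^n}{1-q}$, $(\rho;q)_0=1$ and $(\rho;q)_n=(1-\rho)(1-\rho q)\cdots(1-\rho q^{n-1})$ for $n\ge1$. For $g\in\mathfrak{C}([0,1])$ (continuous real functions on $[0,1]$), $x\in[0,1]$, $n\in\mathbb{N}$, the $q$-Lagrange-Hermite operator is $$\mathfrak{R}_{n,q}^{\alpha^{(1)},\dots,\alpha^{(r)}}(g;x)=\Big\{\prod_{i=1}^r(\alpha_n^{(i)}x^i;q)_n\Big\}\sum_{p=0}^\infty\Bigg\{\sum_{l_1+2l_2+\cdots+rl_r=p}\Big\{\prod_{k=1}^r(q^n;q)_{l_k}\frac{(\alpha_n^{(k)})^{l_k}}{(q;q)_{l_k}}\Big\}\,g\Big(\frac{[l_1]_q}{[n+l_1-1]_q}\Big)\Bigg\}x^p,$$ where the inner sum is over non-negative integers $l_1,\dots,l_r$, and for $n=1$, $l_1=0$ the argument $[0]_q/[0]_q$ of $g$ is read as $0$. Let $\langle b_n\rangle,\langle c_n\rangle$ be sequences of non-negative integers with $b_n<c_n$ and $c_n\to\infty$, let $\langle s_n\rangle$ be a sequence of non-negative reals, and $S_n=\sum_{m=b_n+1}^{c_n}s_m>0$. A real sequence $\langle x_n\rangle$ is deferred weighted summable to $l$ if $\lim_{n\to\infty}\frac1{S_n}\sum_{m=b_n+1}^{c_n}s_mx_m=l$. An infinite real matrix $A=(a_{n,k})_{n,k\ge 1}$ is deferred weighted regular if for every convergent sequence $x=\langle x_k\rangle$ the transform $(Ax)_n=\sum_{k=1}^\infty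 a_{n,k}x_k$ is defined for every $n$ and the sequence $\langle (Ax)_n\rangle$ is deferred weighted summable to $\lim_k x_k$. It is non-negative if all $a_{n,k}\ge0$. For a non-negative deferred weighted regular matrix $A$, a real sequence $\langle x_n\rangle$ is deferred weighted $A$-statistically convergent to $l$, written $stat_A^{DW}\text{-}\lim_n x_n=l$, if for every $\epsilon>0$, with $K_\epsilon=\{k\in\mathbb{N}:|x_k-l|\ge\epsilon\}$, $$\lim_{n\to\infty}\frac1{S_n}\sum_{m=b_n+1}^{c_n}\sum_{k\in K_\epsilon}s_m a_{m,k}=0.$$ *)

theory Defs
  imports "HOL-Analysis.Analysis"
begin

text \<open>
  All sequences and matrices are indexed from 1, as in the mathematics; the value at the index 0
  of a function on \<open>nat\<close> is never used.
\<close>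

section \<open>The q-Lagrange-Hermite operators\<close>

definition q_int :: "real \<Rightarrow> nat \<Rightarrow> real" where
  "q_int q n = (1 - q ^ n) / (1 - q)"

definition q_shifted :: "real \<Rightarrow> real \<Rightarrow> nat \<Rightarrow> real" where
  "q_shifted \<rho> q n = (\<Prod>i<n. 1 - \<rho> * q ^ i)"

text \<open>
  The tuples \<open>(l 1, \<dots>, l r)\<close> with \<open>l 1 + 2 * l 2 + \<dots> + r * l r = p\<close>; extensionality makes
  each tuple occur exactly once.
\<close>

definition weighted_tuples :: "nat \<Rightarrow> nat \<Rightarrow> (nat \<Rightarrow> nat) set" where
  "weighted_tuples r p = {l \<in> {1..r} \<rightarrow>\<^sub>E UNIV. (\<Sum>k=1..r. k * l k) = p}"

lemma finite_weighted_tuples: "finite (weighted_tuples r p)"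
proof (rule finite_subset)
  show "weighted_tuples r p \<subseteq> {1..r} \<rightarrow>\<^sub>E {..p}"
  proof
    fix l assume l: "l \<in> weighted_tuples r p"
    have "l k \<le> p" if k: "k \<in> {1..r}" for k
    proof -
      have "l k \<le> k * l k" using k by simp
      also have "\<dots> \<le> (\<Sum>k=1..r. k * l k)" using k by (intro member_le_sum) auto
      also have "\<dots> = p" using l by (simp add: weighted_tuples_def)
      finally show ?thesis .
    qed
    then show "l \<in> {1..r} \<rightarrow>\<^sub>E {..p}"
      using l by (auto simp: weighted_tuples_def PiE_iff)
  qed
qed (simp add: finite_PiE)

text \<open>
  The argument \<open>\<alpha> j n\<close> stands for the \<open>n\<close>-th term of the \<open>j\<close>-th sequence.
  For \<open>n = 1\<close> and \<open>l 1 = 0\<close> the argument of \<open>g\<close> is \<open>0 / 0\<close>, which is \<open>0\<close> in HOL, in accordance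
  with the convention for that term.
\<close>

definition q_lagrange_hermite ::
  "nat \<Rightarrow> (nat \<Rightarrow> nat \<Rightarrow> real) \<Rightarrow> nat \<Rightarrow> real \<Rightarrow> (real \<Rightarrow> real) \<Rightarrow> real \<Rightarrow> real" where
  "q_lagrange_hermite r \<alpha> n q g x =
     (\<Prod>i=1..r. q_shifted (\<alpha> i n * x ^ i) q n) *
     (\<Sum>p. (\<Sum>l\<in>weighted_tuples r p.
              (\<Prod>k=1..r. q_shifted (q ^ n) q (l k) * (\<alpha> k n ^ l k / q_shifted q q (l k))) *
              g (q_int q (l 1) / q_int q (n + l 1 - 1))) * x ^ p)"

definition sup_norm01 :: "(real \<Rightarrow> real) \<Rightarrow> real" where
  "sup_norm01 f = (SUP x\<in>{0..1}. \<bar>f x\<bar>)"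


section \<open>Deferred weighted statistical convergence\<close>

definition deferred_total :: "(nat \<Rightarrow> nat) \<Rightarrow> (nat \<Rightarrow> nat) \<Rightarrow> (nat \<Rightarrow> real) \<Rightarrow> nat \<Rightarrow> real" where
  "deferred_total b c s n = (\<Sum>m=b n + 1..c n. s m)"

definition deferred_weighted_summable ::
  "(nat \<Rightarrow> nat) \<Rightarrow> (nat \<Rightarrow> nat) \<Rightarrow> (nat \<Rightarrow> real) \<Rightarrow> (nat \<Rightarrow> real) \<Rightarrow> real \<Rightarrow> bool" where
  "deferred_weighted_summable b c s x l \<longleftrightarrow>
     (\<lambda>n. 1 / deferred_total b c s n * (\<Sum>m=b n + 1..c n. s m * x m)) \<longlonglongrightarrow> l"

text \<open>
  The series defining the matrix transform is an ordinary, possibly only conditionally convergent,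
  series over \<open>k = 1, 2, \<dots>\<close>; hence the shift by one.
\<close>

definition deferred_weighted_regular ::
  "(nat \<Rightarrow> nat) \<Rightarrow> (nat \<Rightarrow> nat) \<Rightarrow> (nat \<Rightarrow> real) \<Rightarrow> (nat \<Rightarrow> nat \<Rightarrow> real) \<Rightarrow> bool" where
  "deferred_weighted_regular b c s A \<longleftrightarrow>
     (\<forall>x l. x \<longlonglongrightarrow> l \<longrightarrow>
        (\<forall>n\<ge>1. summable (\<lambda>k. A n (Suc k) * x (Suc k))) \<and>
        deferred_weighted_summable b c s (\<lambda>n. \<Sum>k. A n (Suc k) * x (Suc k)) l)"

text \<open>
  Intended for non-negative deferred weighted regular \<open>A\<close>: then the rows of \<open>A\<close> are absolutely
  summable and the unordered sums below exist.
\<close>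

definition deferred_weighted_stat_convergent ::
  "(nat \<Rightarrow> nat) \<Rightarrow> (nat \<Rightarrow> nat) \<Rightarrow> (nat \<Rightarrow> real) \<Rightarrow> (nat \<Rightarrow> nat \<Rightarrow> real) \<Rightarrow>
     (nat \<Rightarrow> real) \<Rightarrow> real \<Rightarrow> bool" where
  "deferred_weighted_stat_convergent b c s A x l \<longleftrightarrow>
     (\<forall>\<epsilon>>0. (\<lambda>n. 1 / deferred_total b c s n *
        (\<Sum>m=b n + 1..c n. \<Sum>\<^sub>\<infinity>k\<in>{k. k \<ge> 1 \<and> \<bar>x k - l\<bar> \<ge> \<epsilon>}. s m * A m k)) \<longlonglongrightarrow> 0)"

end

theory Submission imports Defs begin

text \<open>
  The operator is an expectation: by the \<open>q\<close>-binomial theorem the variables \<open>l 2, \<dots>, l r\<close> sum out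
  against the normalising product, so its value at \<open>x\<close> is the mean of \<open>g (T l)\<close> with respect to the
  probability weights \<open>(z;q)\<^sub>n (q\<^sup>n;q)\<^sub>l / (q;q)\<^sub>l z\<^sup>l\<close>, where \<open>z\<close> is the product of \<open>x\<close> and the
  \<open>n\<close>-th term of the first sequence, and \<open>T l = [l] / [n + l - 1]\<close>. Since \<open>T (l + 1)\<close> times the
  coefficient with index \<open>l + 1\<close> is the coefficient with index \<open>l\<close>, the mean of \<open>T\<close> is \<open>z\<close> and that of
  \<open>T\<^sup>2\<close> is at most \<open>z / [n] + z\<^sup>2\<close>. Hence the mean square distance of \<open>T\<close> from \<open>x\<close> tends to 0
  uniformly in \<open>x\<close>, and the sup-norms converge to 0 in the ordinary sense. A regular matrix assigns
  limit 0 to the indicator sequence of a finite set, so ordinary convergence implies statistical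
  convergence.
\<close>

section \<open>Absolute convergence of multiple series\<close>

text \<open>A finite set \<open>F\<close> of tuples lies in the box of its finite coordinate
  projections \<open>C x\<close>. Over a box the sum of products factors into a product of sums, so
  every finite partial sum is at most the product of the full single sums.\<close>

lemma abs_summable_on_prod_PiE:
  fixes f :: "'a \<Rightarrow> 'b \<Rightarrow> 'c :: {real_normed_div_algebra, comm_semiring_1}"
  assumes "finite A" and "\<And>x. x \<in> A \<Longrightarrow> (\<lambda>y. norm (f x y)) summable_on B x"
  shows "(\<lambda>h. norm (\<Prod>x\<in>A. f x (h x))) summable_on PiE A B"
proof (rule nonneg_bdd_above_summable_on)
  show "bdd_above (sum (\<lambda>h. norm (\<Prod>x\<in>A. f x (h x))) ` {F. F \<subseteq> PiE A B \<and> finite F})"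
  proof (rule bdd_aboveI2)
    fix F assume "F \<in> {F. F \<subseteq> PiE A B \<and> finite F}"
    then have F: "F \<subseteq> PiE A B" "finite F" by auto
    define C where "C = (\<lambda>x. (\<lambda>h. h x) ` F)"
    have fin: "finite (C x)" for x using F by (simp add: C_def)
    have "F \<subseteq> PiE A C" using F by (auto simp: C_def PiE_iff)
    then have "(\<Sum>h\<in>F. norm (\<Prod>x\<in>A. f x (h x))) \<le> (\<Sum>h\<in>PiE A C. norm (\<Prod>x\<in>A. f x (h x)))"
      by (intro sum_mono2) (auto intro: finite_PiE assms(1) fin)
    also have "\<dots> = (\<Prod>x\<in>A. \<Sum>y\<in>C x. norm (f x y))"
      by (subst prod_sum_PiE) (auto simp: assms(1) fin prod_norm)
    also have "\<dots> \<le> (\<Prod>x\<in>A. \<Sum>\<^sub>\<infinity>y\<in>B x. norm (f x y))"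
    proof (intro prod_mono conjI sum_nonneg norm_ge_zero)
      fix x assume "x \<in> A"
      then show "(\<Sum>y\<in>C x. norm (f x y)) \<le> (\<Sum>\<^sub>\<infinity>y\<in>B x. norm (f x y))"
        using F by (intro finite_sum_le_infsum assms(2) fin) (auto simp: C_def PiE_iff)
    qed
    finally show "(\<Sum>h\<in>F. norm (\<Prod>x\<in>A. f x (h x))) \<le> (\<Prod>x\<in>A. \<Sum>\<^sub>\<infinity>y\<in>B x. norm (f x y))" .
  qed
qed simp


section \<open>The weights and nodes of the operator\<close>

text \<open>For \<open>n >= 1\<close> this is the Gaussian binomial coefficient n + l - 1 over l;
  for \<open>n = 0\<close> it is 1 at \<open>l = 0\<close> and 0 elsewhere.\<close>

definition q_coeff :: "real \<Rightarrow> nat \<Rightarrow> nat \<Rightarrow> real" where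
  "q_coeff q n l = q_shifted (q ^ n) q l / q_shifted q q l"

definition node :: "real \<Rightarrow> nat \<Rightarrow> nat \<Rightarrow> real" where
  "node q n l = q_int q l / q_int q (n + l - 1)"

lemma q_shifted_0 [simp]: "q_shifted \<rho> q 0 = 1"
  by (simp add: q_shifted_def)

lemma q_shifted_Suc: "q_shifted \<rho> q (Suc l) = q_shifted \<rho> q l * (1 - \<rho> * q ^ l)"
  by (simp add: q_shifted_def)

lemma q_shifted_Suc_shift: "q_shifted \<rho> q (Suc l) = (1 - \<rho>) * q_shifted (q * \<rho>) q l"
  unfolding q_shifted_def prod.lessThan_Suc_shift by (simp add: mult_ac)

context
  fixes q :: real
  assumes q: "0 < q" "q < 1"
begin

lemma q_shifted_pos:
  assumes "0 \<le> \<rho>" "\<rho> < 1"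
  shows "0 < q_shifted \<rho> q l"
proof -
  have "\<rho> * q ^ i < 1" for i
    using mult_left_le[of "q ^ i" \<rho>] power_le_one[of q i] assms q by linarith
  then show ?thesis by (simp add: q_shifted_def prod_pos)
qed

lemma q_coeff_nonneg: "0 \<le> q_coeff q n l"
proof -
  have "0 \<le> 1 - q ^ n * q ^ i" for i
    using power_le_one[of q "n + i"] q by (simp add: power_add)
  then have "0 \<le> q_shifted (q ^ n) q l" by (simp add: q_shifted_def prod_nonneg)
  then show ?thesis using q_shifted_pos[of q l] q by (simp add: q_coeff_def)
qed

lemma q_coeff_0 [simp]: "q_coeff q n 0 = 1"
  by (simp add: q_coeff_def)

section \<open>The q-binomial theorem\<close>

text \<open>A q-Pascal rule. After the common factor \<open>?N\<close> and the common denominator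
  are removed, it reads 1 - q^(n+l+1) = (1 - q^n) + q^n (1 - q^(l+1)).\<close>

lemma q_coeff_Suc:
  "q_coeff q (Suc n) (Suc l) = q_coeff q n (Suc l) + q ^ n * q_coeff q (Suc n) l"
proof -
  let ?N = "q_shifted (q ^ Suc n) q l"
  have *: "q_shifted q q l > 0" "q_shifted q q (Suc l) > 0"
    using q by (auto intro: q_shifted_pos)
  have "1 - q * q ^ l \<noteq> 0" using * by (auto simp: q_shifted_Suc)
  moreover have "q_shifted (q ^ n) q (Suc l) = (1 - q ^ n) * ?N"
    by (simp add: q_shifted_Suc_shift)
  moreover have "q_shifted (q ^ Suc n) q (Suc l) = ?N * (1 - q ^ Suc n * q ^ l)"
    by (rule q_shifted_Suc)
  moreover have "q_shifted q q (Suc l) = q_shifted q q l * (1 - q * q ^ l)"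
    by (rule q_shifted_Suc)
  ultimately show ?thesis
    using * unfolding q_coeff_def by (simp add: divide_simps) (simp add: algebra_simps)
qed

text \<open>The \<open>q\<close>-binomial theorem: by the recurrence above, multiplying the series for \<open>n + 1\<close> by \<open>1 - z q\<^sup>n\<close> gives the series for \<open>n\<close>.\<close>

lemma q_coeff_sums:
  assumes z: "0 \<le> z" "z < 1"
  shows "(\<lambda>l. q_coeff q n l * z ^ l) sums (1 / q_shifted z q n)"
proof (induction n)
  case 0
  have "q_coeff q 0 (Suc l) = 0" for l
    by (simp add: q_coeff_def q_shifted_Suc_shift)
  then have "(\<lambda>l. q_coeff q 0 (Suc l) * z ^ Suc l) sums 0" by simp
  then show ?case by (subst (asm) sums_Suc_iff) simp
next
  case (Suc n)
  define f where "f = (\<lambda>l. q_coeff q n l * z ^ l)"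
  define h where "h = (\<lambda>l. q_coeff q (Suc n) l * z ^ l)"
  define w where "w = z * q ^ n"
  have w: "0 \<le> w" "w < 1"
    using mult_left_le[of "q ^ n" z] power_le_one[of q n] z q by (auto simp: w_def intro: le_less_trans)
  have f_nonneg: "0 \<le> f l" and h_nonneg: "0 \<le> h l" for l
    using z by (auto simp: f_def h_def q_coeff_nonneg)
  have h_Suc: "h (Suc l) = f (Suc l) + w * h l" for l
    unfolding f_def h_def w_def q_coeff_Suc by (simp add: algebra_simps)
  have sf: "summable f" using Suc by (simp add: f_def sums_iff)
  \<comment> \<open>Convergence of \<open>h\<close> must be shown before its sum can be computed.
    The recurrence expresses the partial sum up to \<open>Suc N\<close> by the one up to
    \<open>N\<close>; as these sums increase, both can be compared and the inequality solved for the
    latter.\<close>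
  have "(\<Sum>i<N. h i) \<le> suminf f / (1 - w)" for N
  proof -
    have "(\<Sum>i<Suc N. h i) = (\<Sum>i<Suc N. f i) + w * (\<Sum>i<N. h i)" for N
      unfolding sum.lessThan_Suc_shift h_Suc sum.distrib sum_distrib_left by (simp add: f_def h_def)
    moreover have "(\<Sum>i<Suc N. f i) \<le> suminf f"
      using sf f_nonneg by (intro sum_le_suminf) auto
    moreover have "(\<Sum>i<N. h i) \<le> (\<Sum>i<Suc N. h i)" using h_nonneg[of N] by simp
    ultimately have "(\<Sum>i<N. h i) * (1 - w) \<le> suminf f" by (simp add: algebra_simps)
    then show ?thesis using w by (simp add: pos_le_divide_eq)
  qed
  then have sh: "summable h" using h_nonneg by (intro summableI_nonneg_bounded)
  have "suminf h = h 0 + (\<Sum>l. f (Suc l) + w * h l)"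
    using suminf_split_head[OF sh] by (simp add: h_Suc)
  also have "(\<Sum>l. f (Suc l) + w * h l) = (suminf f - f 0) + w * suminf h"
    using sf sh suminf_split_head[OF sf]
    by (subst suminf_add[symmetric]) (auto simp: summable_Suc_iff suminf_mult)
  finally have "suminf h * (1 - w) = suminf f"
    by (simp add: f_def h_def algebra_simps)
  also have "\<dots> = 1 / q_shifted z q n" using Suc by (simp add: f_def sums_iff)
  finally have "suminf h = 1 / q_shifted z q (Suc n)"
    using w q_shifted_pos[OF z, of n] by (simp add: q_shifted_Suc eq_divide_eq mult_ac flip: w_def)
  then show ?case using sh by (simp add: h_def sums_iff)
qed

section \<open>Nodes and their moments\<close>

lemma q_int_mono:
  assumes "m \<le> n"
  shows "q_int q m \<le> q_int q n"
  using power_decreasing[OF assms, of q] q by (auto simp: q_int_def intro!: divide_right_mono)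

lemma q_int_nonneg: "0 \<le> q_int q n"
  using q_int_mono[of 0 n] by (simp add: q_int_def)

lemma q_int_pos: "0 < n \<Longrightarrow> 0 < q_int q n"
  using q by (simp add: q_int_def power_less_one_iff)

lemma node_0 [simp]: "node q n 0 = 0"
  by (simp add: node_def q_int_def)

lemma node_bounds:
  assumes "n \<ge> 1"
  shows "0 \<le> node q n l" "node q n l \<le> 1"
  using q_int_nonneg q_int_mono[of l "n + l - 1"] assms
  by (auto simp: node_def divide_le_eq_1 intro: order.antisym)

text \<open>The node [l+1] / [n+l] is the reciprocal of the ratio of consecutive coefficients, (1 -
  q^(n+l)) / (1 - q^(l+1)). The assumption \<open>n >= 1\<close> keeps 1 - q^(n+l) away from
  0.\<close>

lemma q_coeff_node_Suc:
  assumes "n \<ge> 1"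
  shows "q_coeff q n (Suc l) * node q n (Suc l) = q_coeff q n l"
proof -
  have "q ^ n * q ^ l < 1"
    using assms q by (subst power_add[symmetric]) (simp add: power_less_one_iff)
  moreover have "q * q ^ l < 1" using power_Suc_less_one[of q l] q by simp
  ultimately show ?thesis
    using q by (simp add: q_coeff_def node_def q_int_def q_shifted_Suc power_add)
qed

text \<open>Since [l+1] = 1 + q [l] is at most 1 + [l], the node splits into two fractions over
  [n+l]; the denominator is then lowered to [n] in the first and to [n+l-1] in the second.\<close>

lemma node_Suc_le:
  assumes "n \<ge> 1"
  shows "node q n (Suc l) \<le> 1 / q_int q n + node q n l"
proof -
  have "q_int q (Suc l) = 1 + q * q_int q l"
    using q by (simp add: q_int_def field_simps)
  moreover have "q * q_int q l \<le> q_int q l"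
    using q q_int_nonneg[of l] by (simp add: mult_left_le_one_le)
  ultimately have "node q n (Suc l) \<le> (1 + q_int q l) / q_int q (n + l)"
    using q_int_nonneg by (auto simp: node_def intro!: divide_right_mono)
  also have "\<dots> = 1 / q_int q (n + l) + q_int q l / q_int q (n + l)"
    by (rule add_divide_distrib)
  also have "1 / q_int q (n + l) \<le> 1 / q_int q n"
    using assms by (intro divide_left_mono q_int_mono mult_pos_pos q_int_pos) auto
  also have "q_int q l / q_int q (n + l) \<le> node q n l"
  \<comment> \<open>For \<open>n = 1\<close> and \<open>l = 0\<close> the denominator on the right
    is 0, so comparing denominators works only for positive \<open>l\<close>.\<close>
  proof (cases l)
    case 0
    then show ?thesis by (simp add: q_int_def)
  next
    case (Suc m)
    then show ?thesis
      using assms unfolding node_def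
      by (intro divide_left_mono q_int_mono mult_pos_pos q_int_pos q_int_nonneg) auto
  qed
  finally show ?thesis by simp
qed

text \<open>The mean of the nodes is exactly \<open>z\<close>, so expanding the square around an
  arbitrary \<open>x\<close> completes to (z - x)^2, and only the excess 1 / [n] of the second
  moment over z^2 is left.\<close>

lemma node_variance:
  assumes n: "n \<ge> 1" and z: "0 \<le> z" "z < 1"
  defines "p \<equiv> (\<lambda>l. q_shifted z q n * (q_coeff q n l * z ^ l))"
  shows "summable (\<lambda>l. p l * (node q n l - x)\<^sup>2)"
    and "(\<Sum>l. p l * (node q n l - x)\<^sup>2) \<le> 1 / q_int q n + (z - x)\<^sup>2"
proof -
  let ?T = "node q n"
  have P: "0 < q_shifted z q n" using z by (rule q_shifted_pos)
  have p_nonneg: "0 \<le> p l" for l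
    using P z by (simp add: p_def q_coeff_nonneg)
  have p0: "p sums 1"
    using sums_mult[OF q_coeff_sums[OF z, of n], of "q_shifted z q n"] P by (simp add: p_def)
  have p_Suc: "p (Suc l) * ?T (Suc l) = z * p l" for l
    using q_coeff_node_Suc[OF n, of l, symmetric] by (simp add: p_def)
  have "(\<lambda>l. p (Suc l) * ?T (Suc l)) sums z"
    using sums_mult[OF p0, of z] by (simp add: p_Suc)
  \<comment> \<open>The index shift loses nothing, because the node at \<open>l = 0\<close> is
    0.\<close>
  then have p1: "(\<lambda>l. p l * ?T l) sums z"
    by (subst (asm) sums_Suc_iff) simp
  have s2: "summable (\<lambda>l. p l * (?T l)\<^sup>2)"
    using p_nonneg node_bounds[OF n]
    by (intro summable_comparison_test'[OF sums_summable[OF p0], of 0])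
       (auto simp: mult_left_le power_le_one)
  \<comment> \<open>One of the two node factors is absorbed exactly by \<open>p_Suc\<close>; the
    other is estimated by \<open>node_Suc_le\<close>.\<close>
  have "(\<Sum>l. p l * (?T l)\<^sup>2) = (\<Sum>l. p (Suc l) * (?T (Suc l))\<^sup>2)"
    using suminf_split_head[OF s2] by simp
  also have "\<dots> \<le> (\<Sum>l. z * (p l * (1 / q_int q n) + p l * ?T l))"
  proof (rule suminf_le)
    fix l
    have "p (Suc l) * (?T (Suc l))\<^sup>2 = z * p l * ?T (Suc l)"
      by (simp add: p_Suc[symmetric] power2_eq_square)
    also have "\<dots> \<le> z * p l * (1 / q_int q n + ?T l)"
      using z p_nonneg by (intro mult_left_mono node_Suc_le n) auto
    finally show "p (Suc l) * (?T (Suc l))\<^sup>2 \<le> z * (p l * (1 / q_int q n) + p l * ?T l)"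
      by (simp add: algebra_simps)
    show "summable (\<lambda>l. p (Suc l) * (?T (Suc l))\<^sup>2)"
      using s2 by (subst summable_Suc_iff)
    show "summable (\<lambda>l. z * (p l * (1 / q_int q n) + p l * ?T l))"
      by (intro summable_mult summable_add summable_mult2 sums_summable[OF p0] sums_summable[OF p1])
  qed
  also have "\<dots> = z * (1 * (1 / q_int q n) + z)"
    by (intro sums_unique[symmetric] sums_mult sums_add sums_mult2 p0 p1)
  also have "\<dots> \<le> 1 / q_int q n + z\<^sup>2"
    using z q_int_nonneg[of n] mult_right_mono[of z 1 "1 / q_int q n"]
    by (simp add: power2_eq_square algebra_simps)
  finally have m2: "(\<Sum>l. p l * (?T l)\<^sup>2) \<le> 1 / q_int q n + z\<^sup>2" .
  have "(\<lambda>l. p l * (?T l)\<^sup>2 + (x\<^sup>2 * p l - 2 * x * (p l * ?T l)))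
          sums ((\<Sum>l. p l * (?T l)\<^sup>2) + (x\<^sup>2 * 1 - 2 * x * z))"
    by (intro sums_add sums_diff sums_mult p0 p1 summable_sums s2)
  moreover have "(\<lambda>l. p l * (?T l)\<^sup>2 + (x\<^sup>2 * p l - 2 * x * (p l * ?T l))) = (\<lambda>l. p l * (?T l - x)\<^sup>2)"
    by (simp add: fun_eq_iff power2_eq_square algebra_simps)
  ultimately have sm: "(\<lambda>l. p l * (?T l - x)\<^sup>2) sums ((\<Sum>l. p l * (?T l)\<^sup>2) + (x\<^sup>2 * 1 - 2 * x * z))"
    by simp
  then show "summable (\<lambda>l. p l * (?T l - x)\<^sup>2)" by (rule sums_summable)
  have "(\<Sum>l. p l * (?T l - x)\<^sup>2) = (\<Sum>l. p l * (?T l)\<^sup>2) + (x\<^sup>2 * 1 - 2 * x * z)"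
    using sm by (rule sums_unique[symmetric])
  then show "(\<Sum>l. p l * (?T l - x)\<^sup>2) \<le> 1 / q_int q n + (z - x)\<^sup>2"
    using m2 by (simp add: power2_eq_square algebra_simps)
qed

section \<open>Reduction of the operator to a single series\<close>

text \<open>Boundedness of \<open>g\<close> gives absolute convergence, so the grouping by
  \<open>p\<close> can be undone and the sum over all tuples factors into \<open>r\<close> single
  series. For \<open>k > 1\<close> the series is cancelled by the prefactor
  \<open>P k\<close>.\<close>

lemma q_lagrange_hermite_eq:
  assumes r: "r \<ge> 1" and n: "n \<ge> 1"
    and \<alpha>: "\<And>k. 1 \<le> k \<Longrightarrow> k \<le> r \<Longrightarrow> 0 < \<alpha> k n \<and> \<alpha> k n < 1"
    and x: "0 \<le> x" "x \<le> 1"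
    and g: "\<And>t. 0 \<le> t \<Longrightarrow> t \<le> 1 \<Longrightarrow> \<bar>g t\<bar> \<le> M"
  shows "(\<lambda>l. q_shifted (\<alpha> 1 n * x) q n * (q_coeff q n l * (\<alpha> 1 n * x) ^ l) * g (node q n l))
           sums q_lagrange_hermite r \<alpha> n q g x"
proof -
  define z where "z = (\<lambda>k. \<alpha> k n * x ^ k)"
  define P where "P = (\<lambda>k. q_shifted (z k) q n)"
  define u where "u = (\<lambda>k l. q_coeff q n l * z k ^ l)"
  \<comment> \<open>The value of \<open>g\<close> depends on \<open>l 1\<close> only, so attaching
    it to the first factor makes the summand a product over the coordinates.\<close>
  define f where "f = (\<lambda>k l. u k l * (if k = 1 then g (node q n l) else 1))"
  define F where "F = (\<lambda>l. \<Prod>k\<in>{1..r}. f k (l k))"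
  have z: "0 \<le> z k" "z k < 1" if "k \<in> {1..r}" for k
  proof -
    have "0 < \<alpha> k n" "\<alpha> k n < 1" using \<alpha>[of k] that by auto
    then show "0 \<le> z k" "z k < 1"
      using mult_left_le[of "x ^ k" "\<alpha> k n"] power_le_one[of x k] x
      unfolding z_def by (simp, linarith)
  qed
  have P: "0 < P k" if "k \<in> {1..r}" for k
    unfolding P_def using z[OF that] by (rule q_shifted_pos)
  have u_sums: "u k sums (1 / P k)" if "k \<in> {1..r}" for k
    unfolding u_def P_def using z[OF that] by (rule q_coeff_sums)
  have u_nonneg: "0 \<le> u k l" if "k \<in> {1..r}" for k l
    using z[OF that] by (simp add: u_def q_coeff_nonneg)
  \<comment> \<open>The constant \<open>1 + M\<close> dominates both cases: \<open>M\<close> bounds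
    the first factor, 1 the others, and \<open>M\<close> is non-negative as a bound of absolute
    values.\<close>
  have norm_f: "norm (f k l) \<le> (1 + M) * u k l" if k: "k \<in> {1..r}" for k l
  proof -
    have "\<bar>g (node q n l)\<bar> \<le> M" using node_bounds[OF n] by (intro g)
    then have "\<bar>if k = 1 then g (node q n l) else 1\<bar> \<le> 1 + M" by auto
    then have "u k l * \<bar>if k = 1 then g (node q n l) else 1\<bar> \<le> u k l * (1 + M)"
      using u_nonneg[OF k] by (intro mult_left_mono) auto
    then show ?thesis using u_nonneg[OF k] by (simp add: f_def abs_mult mult_ac)
  qed
  have norm_summable: "summable (\<lambda>l. norm (f k l))" if k: "k \<in> {1..r}" for k
    using norm_f[OF k]
    by (intro summable_comparison_test'[OF summable_mult[OF sums_summable[OF u_sums[OF k]]], of 0]) auto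
  have f_abs: "(\<lambda>l. norm (f k l)) summable_on UNIV" if k: "k \<in> {1..r}" for k
    using norm_summable[OF k] by (intro norm_summable_imp_summable_on) simp
  have f_infsum: "infsum (f k) UNIV = suminf (f k)" if k: "k \<in> {1..r}" for k
    by (rule infsumI, rule norm_summable_imp_has_sum[OF norm_summable[OF k]],
        rule summable_sums[OF summable_norm_cancel[OF norm_summable[OF k]]])
  have "(\<lambda>l. norm (F l)) summable_on ({1..r} \<rightarrow>\<^sub>E UNIV)"
    unfolding F_def by (intro abs_summable_on_prod_PiE f_abs) auto
  then have "(F has_sum infsum F ({1..r} \<rightarrow>\<^sub>E UNIV)) ({1..r} \<rightarrow>\<^sub>E UNIV)"
    by (rule has_sum_infsum[OF abs_summable_summable])
  also have "infsum F ({1..r} \<rightarrow>\<^sub>E UNIV) = (\<Prod>k=1..r. suminf (f k))"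
    unfolding F_def
    using infsum_prod_PiE_abs[of "{1..r}" f "\<lambda>_. UNIV", OF _ f_abs] by (simp add: f_infsum)
  finally have "(F has_sum (\<Prod>k=1..r. suminf (f k))) ({1..r} \<rightarrow>\<^sub>E UNIV)" .
  \<comment> \<open>Each tuple has exactly one weighted degree \<open>p\<close>, so summing over
    \<open>p\<close> and then over the tuples of degree \<open>p\<close> runs through every tuple
    once.\<close>
  moreover have "bij_betw snd (Sigma UNIV (weighted_tuples r)) ({1..r} \<rightarrow>\<^sub>E UNIV)"
    unfolding bij_betw_def
  proof
    show "inj_on snd (Sigma UNIV (weighted_tuples r))"
      by (rule inj_onI) (clarsimp simp: weighted_tuples_def)
    have "snd ` Sigma UNIV (weighted_tuples r) = (\<Union>p. weighted_tuples r p)"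
      by (rule snd_image_Sigma)
    also have "\<dots> = ({1..r} \<rightarrow>\<^sub>E UNIV)"
      by (simp add: weighted_tuples_def set_eq_iff)
    finally show "snd ` Sigma UNIV (weighted_tuples r) = ({1..r} \<rightarrow>\<^sub>E UNIV)" .
  qed
  ultimately have "((\<lambda>y. F (snd y)) has_sum (\<Prod>k=1..r. suminf (f k))) (Sigma UNIV (weighted_tuples r))"
    using has_sum_reindex_bij_betw by blast
  then have "((\<lambda>p. \<Sum>l\<in>weighted_tuples r p. F l) has_sum (\<Prod>k=1..r. suminf (f k))) UNIV"
    by (rule has_sum_Sigma') (simp add: has_sum_finite finite_weighted_tuples)
  then have "(\<lambda>p. \<Sum>l\<in>weighted_tuples r p. F l) sums (\<Prod>k=1..r. suminf (f k))"
    by (rule has_sum_imp_sums)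
  moreover have "F l = (\<Prod>k=1..r. q_shifted (q ^ n) q (l k) * (\<alpha> k n ^ l k / q_shifted q q (l k))) *
      g (q_int q (l 1) / q_int q (n + l 1 - 1)) * x ^ p" if l: "l \<in> weighted_tuples r p" for l p
  proof -
    \<comment> \<open>Each \<open>z k\<close> contributes \<open>x ^ k\<close>, so the powers of
      \<open>x\<close> collect to the weighted degree of \<open>l\<close>.\<close>
    have "F l = (\<Prod>k=1..r. (q_shifted (q ^ n) q (l k) * (\<alpha> k n ^ l k / q_shifted q q (l k))) *
        x ^ (k * l k) * (if k = 1 then g (node q n (l k)) else 1))"
      unfolding F_def
      by (intro prod.cong) (auto simp: f_def u_def z_def q_coeff_def power_mult power_mult_distrib)
    also have "\<dots> = (\<Prod>k=1..r. q_shifted (q ^ n) q (l k) * (\<alpha> k n ^ l k / q_shifted q q (l k))) *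
        x ^ (\<Sum>k=1..r. k * l k) * (\<Prod>k=1..r. if k = 1 then g (node q n (l k)) else 1)"
      unfolding prod.distrib by (simp add: power_sum)
    also have "(\<Prod>k=1..r. if k = 1 then g (node q n (l k)) else 1) = g (node q n (l 1))"
      using r by (subst prod.delta) auto
    also have "(\<Sum>k=1..r. k * l k) = p" using l by (simp add: weighted_tuples_def)
    finally show ?thesis by (simp add: node_def mult_ac)
  qed
  ultimately have "q_lagrange_hermite r \<alpha> n q g x = (\<Prod>k=1..r. P k) * (\<Prod>k=1..r. suminf (f k))"
    unfolding q_lagrange_hermite_def P_def z_def
    by (simp add: sums_iff sum_distrib_right)
  also have "\<dots> = (\<Prod>k=1..r. if k = 1 then P 1 * suminf (f 1) else 1)"
    unfolding prod.distrib[symmetric]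
  proof (rule prod.cong)
    fix k assume k: "k \<in> {1..r}"
    show "P k * suminf (f k) = (if k = 1 then P 1 * suminf (f 1) else 1)"
    proof (cases "k = 1")
      case False
      then have "f k = u k" by (simp add: f_def fun_eq_iff)
      then show ?thesis using u_sums[OF k] P[OF k] False by (simp add: sums_iff)
    qed simp
  qed simp
  also have "\<dots> = P 1 * suminf (f 1)" using r by (subst prod.delta) auto
  finally have eq: "q_lagrange_hermite r \<alpha> n q g x = P 1 * suminf (f 1)" .
  have "f 1 sums suminf (f 1)"
    using summable_sums[OF summable_norm_cancel[OF norm_summable[of 1]]] r by simp
  then have "(\<lambda>l. P 1 * f 1 l) sums (P 1 * suminf (f 1))" by (rule sums_mult)
  then show ?thesis
    by (simp add: eq P_def f_def u_def z_def mult.assoc)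
qed

text \<open>Averaging \<open>modulus\<close> over the weights, which sum to 1, leaves
  \<open>C\<close> times the mean square distance of the nodes from \<open>x\<close>. As z - x = -x
  (1 - \<alpha> 1 n) with \<open>x\<close> in the unit interval, the bound becomes free of
  \<open>x\<close> once \<open>\<epsilon>\<close> and \<open>C\<close> are.\<close>

lemma q_lagrange_hermite_error:
  assumes r: "r \<ge> 1" and n: "n \<ge> 1"
    and \<alpha>: "\<And>k. 1 \<le> k \<Longrightarrow> k \<le> r \<Longrightarrow> 0 < \<alpha> k n \<and> \<alpha> k n < 1"
    and x: "0 \<le> x" "x \<le> 1"
    and g: "\<And>t. 0 \<le> t \<Longrightarrow> t \<le> 1 \<Longrightarrow> \<bar>g t\<bar> \<le> M"
    and modulus: "\<And>t. 0 \<le> t \<Longrightarrow> t \<le> 1 \<Longrightarrow> \<bar>g t - g x\<bar> \<le> \<epsilon> + C * (t - x)\<^sup>2"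
    and C: "0 \<le> C"
  shows "\<bar>q_lagrange_hermite r \<alpha> n q g x - g x\<bar> \<le> \<epsilon> + C * (1 / q_int q n + (1 - \<alpha> 1 n)\<^sup>2)"
proof -
  define z where "z = \<alpha> 1 n * x"
  define p where "p = (\<lambda>l. q_shifted z q n * (q_coeff q n l * z ^ l))"
  let ?T = "node q n"
  have \<alpha>1: "0 < \<alpha> 1 n" "\<alpha> 1 n < 1" using \<alpha>[of 1] r by auto
  have z: "0 \<le> z" "z < 1"
    using mult_left_le[of x "\<alpha> 1 n"] \<alpha>1 x unfolding z_def by (simp, linarith)
  have P: "0 < q_shifted z q n" using z by (rule q_shifted_pos)
  have p_nonneg: "0 \<le> p l" for l
    using P z by (simp add: p_def q_coeff_nonneg)
  have p0: "p sums 1"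
    using sums_mult[OF q_coeff_sums[OF z, of n], of "q_shifted z q n"] P by (simp add: p_def)
  have var: "summable (\<lambda>l. p l * (?T l - x)\<^sup>2)"
      "(\<Sum>l. p l * (?T l - x)\<^sup>2) \<le> 1 / q_int q n + (z - x)\<^sup>2"
    using node_variance[OF n z, of x] by (simp_all add: p_def)
  have "(\<lambda>l. p l * g (?T l)) sums q_lagrange_hermite r \<alpha> n q g x"
    using q_lagrange_hermite_eq[where \<alpha> = \<alpha> and g = g, OF r n \<alpha> x g] by (simp add: p_def z_def)
  then have "(\<lambda>l. p l * g (?T l) - p l * g x) sums (q_lagrange_hermite r \<alpha> n q g x - 1 * g x)"
    by (intro sums_diff sums_mult2 p0)
  then have R: "(\<lambda>l. p l * (g (?T l) - g x)) sums (q_lagrange_hermite r \<alpha> n q g x - g x)"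
    by (simp add: algebra_simps)
  have major: "(\<lambda>l. \<epsilon> * p l + C * (p l * (?T l - x)\<^sup>2))
      sums (\<epsilon> * 1 + C * (\<Sum>l. p l * (?T l - x)\<^sup>2))"
    by (intro sums_add sums_mult p0 summable_sums var)
  have bound: "norm (p l * (g (?T l) - g x)) \<le> \<epsilon> * p l + C * (p l * (?T l - x)\<^sup>2)" for l
    using mult_left_mono[OF modulus[of "?T l"] p_nonneg[of l]] node_bounds[OF n, of l] p_nonneg[of l]
    by (simp add: abs_mult distrib_left mult_ac)
  have "\<bar>q_lagrange_hermite r \<alpha> n q g x - g x\<bar> \<le> \<epsilon> * 1 + C * (\<Sum>l. p l * (?T l - x)\<^sup>2)"
    using norm_sums_le[OF R major bound] by simp
  also have "\<dots> \<le> \<epsilon> + C * (1 / q_int q n + (1 - \<alpha> 1 n)\<^sup>2)"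
  proof -
    have "(z - x)\<^sup>2 = x\<^sup>2 * (1 - \<alpha> 1 n)\<^sup>2"
      by (simp add: z_def power2_eq_square algebra_simps)
    also have "\<dots> \<le> (1 - \<alpha> 1 n)\<^sup>2"
      using x by (intro mult_left_le_one_le) (auto simp: power_le_one)
    finally show ?thesis using var(2) C by (simp add: mult_left_mono)
  qed
  finally show ?thesis .
qed

end


section \<open>Convergence\<close>

text \<open>The bound \<open>B\<close> ensures that the \<open>SUP\<close> is a genuine supremum;
  non-negativity then follows from its being an upper bound of the value at 0.\<close>

lemma sup_norm01_bounds:
  assumes "\<And>x. 0 \<le> x \<Longrightarrow> x \<le> 1 \<Longrightarrow> \<bar>f x\<bar> \<le> B"
  shows "0 \<le> sup_norm01 f" "sup_norm01 f \<le> B"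
proof -
  have "bdd_above ((\<lambda>x. \<bar>f x\<bar>) ` {0..1})"
    using assms by (intro bdd_aboveI2[where M = B]) auto
  then have "\<bar>f 0\<bar> \<le> sup_norm01 f"
    unfolding sup_norm01_def by (intro cSUP_upper) auto
  then show "0 \<le> sup_norm01 f" by linarith
  show "sup_norm01 f \<le> B"
    unfolding sup_norm01_def using assms by (intro cSUP_least) auto
qed

text \<open>Points closer than \<open>d\<close> are handled by uniform continuity. Otherwise (t -
  x)^2 / d^2 is at least 1, so the crude bound \<open>2 * M\<close> is absorbed by the quadratic
  term; this dictates the constant \<open>2 * M / d\<^sup>2\<close>.\<close>

lemma quadratic_modulus_of_continuity:
  fixes g :: "real \<Rightarrow> real"
  assumes "continuous_on S g" "compact S" "\<epsilon> > 0"
  obtains C where "C \<ge> 0" "\<And>t x. t \<in> S \<Longrightarrow> x \<in> S \<Longrightarrow> \<bar>g t - g x\<bar> \<le> \<epsilon> + C * (t - x)\<^sup>2"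
proof -
  have "bounded (g ` S)"
    using assms compact_continuous_image compact_imp_bounded by blast
  then obtain M where M: "\<And>t. t \<in> S \<Longrightarrow> \<bar>g t\<bar> \<le> M" "M > 0"
    by (auto simp: bounded_pos)
  obtain d where d: "d > 0" "\<And>t x. t \<in> S \<Longrightarrow> x \<in> S \<Longrightarrow> \<bar>t - x\<bar> < d \<Longrightarrow> \<bar>g t - g x\<bar> < \<epsilon>"
    using compact_uniformly_continuous[OF assms(1,2)] assms(3)
    unfolding uniformly_continuous_on_def dist_real_def by metis
  show ?thesis
  proof (rule that)
    show "0 \<le> 2 * M / d\<^sup>2" using M by simp
    fix t x assume tx: "t \<in> S" "x \<in> S"
    show "\<bar>g t - g x\<bar> \<le> \<epsilon> + 2 * M / d\<^sup>2 * (t - x)\<^sup>2"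
    proof (cases "\<bar>t - x\<bar> < d")
      case True
      then have "\<bar>g t - g x\<bar> < \<epsilon>" using d tx by blast
      moreover have "0 \<le> 2 * M / d\<^sup>2 * (t - x)\<^sup>2" using M by simp
      ultimately show ?thesis by linarith
    next
      case False
      then have "d\<^sup>2 \<le> (t - x)\<^sup>2" using d by (simp add: power_mono flip: abs_le_square_iff)
      then have "2 * M * 1 \<le> 2 * M * ((t - x)\<^sup>2 / d\<^sup>2)"
        using d M by (intro mult_left_mono) auto
      moreover have "\<bar>g t - g x\<bar> \<le> 2 * M" using M(1)[OF tx(1)] M(1)[OF tx(2)] by linarith
      ultimately show ?thesis using assms(3) by simp
    qed
  qed
qed

text \<open>In (1 - q) / (1 - q^n) the numerator tends to 0, while \<open>a < 1\<close> keeps the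
  limit of the denominator positive.\<close>

lemma q_int_inverse_tendsto_0:
  assumes "q \<longlonglongrightarrow> 1" "(\<lambda>n. q n ^ n) \<longlonglongrightarrow> a" "a < 1"
  shows "(\<lambda>n. 1 / q_int (q n) n) \<longlonglongrightarrow> 0"
proof -
  have "(\<lambda>n. (1 - q n) / (1 - q n ^ n)) \<longlonglongrightarrow> (1 - 1) / (1 - a)"
    using assms by (intro tendsto_intros) auto
  then show ?thesis by (simp add: q_int_def)
qed

lemma q_lagrange_hermite_tendsto:
  assumes r: "r \<ge> 1"
    and \<alpha>: "\<And>j n. 1 \<le> j \<Longrightarrow> j \<le> r \<Longrightarrow> n \<ge> 1 \<Longrightarrow> 0 < \<alpha> j n \<and> \<alpha> j n < 1"
    and \<alpha>1: "(\<lambda>n. \<alpha> 1 n) \<longlonglongrightarrow> 1"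
    and q: "\<And>n. n \<ge> 1 \<Longrightarrow> 0 < q n \<and> q n < 1"
    and q_lim: "q \<longlonglongrightarrow> 1" "(\<lambda>n. q n ^ n) \<longlonglongrightarrow> a" "a < 1"
    and g: "continuous_on {0..1} g"
  shows "(\<lambda>n. sup_norm01 (\<lambda>x. q_lagrange_hermite r \<alpha> n (q n) g x - g x)) \<longlonglongrightarrow> 0"
proof (rule tendstoI)
  fix e :: real assume e: "e > 0"
  let ?N = "\<lambda>n. sup_norm01 (\<lambda>x. q_lagrange_hermite r \<alpha> n (q n) g x - g x)"
  have "bounded (g ` {0..1})"
    using g compact_continuous_image compact_imp_bounded by blast
  then obtain M where M: "\<And>t. 0 \<le> t \<Longrightarrow> t \<le> 1 \<Longrightarrow> \<bar>g t\<bar> \<le> M"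
    unfolding bounded_iff by fastforce
  obtain C where C: "C \<ge> 0"
      "\<And>t x. t \<in> {0..1} \<Longrightarrow> x \<in> {0..1} \<Longrightarrow> \<bar>g t - g x\<bar> \<le> e / 2 + C * (t - x)\<^sup>2"
    using quadratic_modulus_of_continuity[OF g _, of "e / 2"] e by auto
  \<comment> \<open>This bound does not involve \<open>x\<close>, hence it also bounds the sup-norm;
    its limit \<open>e / 2\<close> leaves room below \<open>e\<close>.\<close>
  define B where "B = (\<lambda>n. e / 2 + C * (1 / q_int (q n) n + (1 - \<alpha> 1 n)\<^sup>2))"
  have "B \<longlonglongrightarrow> e / 2 + C * (0 + (1 - 1)\<^sup>2)"
    unfolding B_def using q_int_inverse_tendsto_0[OF q_lim] \<alpha>1 by (intro tendsto_intros)
  then have "eventually (\<lambda>n. B n < e) sequentially"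
    using e by (intro order_tendstoD(2)[of B "e / 2"]) auto
  then show "eventually (\<lambda>n. dist (?N n) 0 < e) sequentially"
    using eventually_ge_at_top[of 1]
  proof eventually_elim
    case (elim n)
    have "\<bar>q_lagrange_hermite r \<alpha> n (q n) g x - g x\<bar> \<le> B n" if "0 \<le> x" "x \<le> 1" for x
      unfolding B_def using elim q \<alpha> r C that M
      by (intro q_lagrange_hermite_error) auto
    then have "0 \<le> ?N n" "?N n \<le> B n" by (fact sup_norm01_bounds)+
    with elim show ?case by simp
  qed
qed

section \<open>Transfer to statistical convergence\<close>

lemma tendsto_imp_deferred_weighted_stat_convergent:
  assumes A: "deferred_weighted_regular b c s A" and x: "x \<longlonglongrightarrow> l"
  shows "deferred_weighted_stat_convergent b c s A x l"
  unfolding deferred_weighted_stat_convergent_def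
proof (intro allI impI)
  fix \<epsilon> :: real assume \<epsilon>: "\<epsilon> > 0"
  define K where "K = {k. k \<ge> 1 \<and> \<bar>x k - l\<bar> \<ge> \<epsilon>}"
  obtain N where N: "\<And>n. n \<ge> N \<Longrightarrow> \<bar>x n - l\<bar> < \<epsilon>"
    using LIMSEQ_D[OF x \<epsilon>] by auto
  then have "K \<subseteq> {..<N}" by (auto simp: K_def not_less[symmetric])
  then have K: "finite K" by (rule finite_subset) simp
  define y :: "nat \<Rightarrow> real" where "y = indicator K"
  have "eventually (\<lambda>n. y n = 0) sequentially"
    using \<open>K \<subseteq> {..<N}\<close> by (intro eventually_sequentiallyI[of N]) (auto simp: y_def indicator_def)
  then have "y \<longlonglongrightarrow> 0" by (rule tendsto_eventually)
  then have "(\<lambda>n. 1 / deferred_total b c s n *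
      (\<Sum>m=b n + 1..c n. s m * (\<Sum>k. A m (Suc k) * y (Suc k)))) \<longlonglongrightarrow> 0"
    using A by (auto simp: deferred_weighted_regular_def deferred_weighted_summable_def)
  moreover have "s m * (\<Sum>k. A m (Suc k) * y (Suc k)) = (\<Sum>\<^sub>\<infinity>k\<in>K. s m * A m k)" for m
  proof -
    have "(\<lambda>k. A m k * y k) sums (\<Sum>k\<in>K. A m k * y k)"
      using K by (intro sums_finite) (auto simp: y_def)
    also have "(\<Sum>k\<in>K. A m k * y k) = (\<Sum>k\<in>K. A m k)" by (simp add: y_def)
    \<comment> \<open>Passing to \<open>Suc k\<close> drops only the term at index 0, which vanishes
      because \<open>K\<close> contains positive indices only.\<close>
    finally have "(\<lambda>k. A m (Suc k) * y (Suc k)) sums (\<Sum>k\<in>K. A m k)"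
      by (subst sums_Suc_iff) (simp add: y_def K_def)
    then show ?thesis using K by (simp add: sums_iff sum_distrib_left)
  qed
  ultimately show "(\<lambda>n. 1 / deferred_total b c s n * (\<Sum>m=b n + 1..c n.
      \<Sum>\<^sub>\<infinity>k\<in>{k. k \<ge> 1 \<and> \<bar>x k - l\<bar> \<ge> \<epsilon>}. s m * A m k)) \<longlonglongrightarrow> 0"
    by (simp add: K_def)
qed

theorem mainTheorem8:
  fixes r :: nat
    and \<alpha> :: "nat \<Rightarrow> nat \<Rightarrow> real"
    and q s :: "nat \<Rightarrow> real"
    and a :: real
    and b c :: "nat \<Rightarrow> nat"
    and A :: "nat \<Rightarrow> nat \<Rightarrow> real"
    and g :: "real \<Rightarrow> real"
  assumes "r \<ge> 1"
    and "\<And>j n. 1 \<le> j \<Longrightarrow> j \<le> r \<Longrightarrow> n \<ge> 1 \<Longrightarrow> 0 < \<alpha> j n \<and> \<alpha> j n < 1"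
    and "(\<lambda>n. \<alpha> 1 n) \<longlonglongrightarrow> 1"
    and "\<And>n. n \<ge> 1 \<Longrightarrow> 0 < q n \<and> q n < 1"
    and "q \<longlonglongrightarrow> 1"
    and "(\<lambda>n. q n ^ n) \<longlonglongrightarrow> a"
    and "0 \<le> a" and "a < 1"
    and "\<And>n. n \<ge> 1 \<Longrightarrow> b n < c n"
    and "filterlim c at_top sequentially"
    and "\<And>n. n \<ge> 1 \<Longrightarrow> s n \<ge> 0"
    and "\<And>n. n \<ge> 1 \<Longrightarrow> deferred_total b c s n > 0"
    and "\<And>n k. n \<ge> 1 \<Longrightarrow> k \<ge> 1 \<Longrightarrow> A n k \<ge> 0"
    and "deferred_weighted_regular b c s A"
    and "continuous_on {0..1} g"
  shows "deferred_weighted_stat_convergent b c s A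
           (\<lambda>n. sup_norm01 (\<lambda>x. q_lagrange_hermite r \<alpha> n (q n) g x - g x)) 0"
  using assms(1-6,8,14,15)
  by (intro tendsto_imp_deferred_weighted_stat_convergent q_lagrange_hermite_tendsto)

end
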